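(* Let $C_1\neq C_2$ be two distinct bivariate copulas with the same diagonal section $\delta(x)=C_1(x,x)=C_2(x,x)$, $x\in[0,1]$, both of which are undominated among copulas with diagonal section $\delta$. Then there exist points $u,v\in[0,1]$, $u\neq v$, such that $$C_1(u,v)>C_2(u,v)\quad\text{and}\quad C_2(v,u)>C_1(v,u).$$
   Context: A bivariate copula is a function $C:[0,1]^2\to[0,1]$ with $C(x,0)=C(0,x)=0$, $C(x,1)=C(1,x)=x$ for all $x\in[0,1]$, and $C(x_2,y_2)-C(x_1,y_2)-C(x_2,y_1)+C(x_1,y_1)\ge0$ whenever $x_1\le x_2$, $y_1\le y_2$. A copula $C$ with diagonal section $\delta$ is called undominated if there is no copula $C'\ne C$ with the same diagonal section $\delta$ such that $C\le C'$ pointwise on $[0,1]^2$. *)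

theory Defs
  imports Complex_Main
begin

(* A function on the unit square is represented by a total function of type
   real \<Rightarrow> real \<Rightarrow> real whose values outside {0..1} x {0..1} are irrelevant.  Every notion
   below, including equality of copulas, is therefore relativised to the unit square. *)

definition copula :: "(real \<Rightarrow> real \<Rightarrow> real) \<Rightarrow> bool" where
  "copula C \<longleftrightarrow>
     (\<forall>x\<in>{0..1}. \<forall>y\<in>{0..1}. C x y \<in> {0..1}) \<and>
     (\<forall>x\<in>{0..1}. C x 0 = 0 \<and> C 0 x = 0 \<and> C x 1 = x \<and> C 1 x = x) \<and>
     (\<forall>x1\<in>{0..1}. \<forall>x2\<in>{0..1}. \<forall>y1\<in>{0..1}. \<forall>y2\<in>{0..1}.
        x1 \<le> x2 \<longrightarrow> y1 \<le> y2 \<longrightarrow> C x2 y2 - C x1 y2 - C x2 y1 + C x1 y1 \<ge> 0)"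

definition has_diagonal_section :: "(real \<Rightarrow> real \<Rightarrow> real) \<Rightarrow> (real \<Rightarrow> real) \<Rightarrow> bool" where
  "has_diagonal_section C \<delta> \<longleftrightarrow> (\<forall>x\<in>{0..1}. C x x = \<delta> x)"

definition eq_on_square :: "(real \<Rightarrow> real \<Rightarrow> real) \<Rightarrow> (real \<Rightarrow> real \<Rightarrow> real) \<Rightarrow> bool" where
  "eq_on_square C C' \<longleftrightarrow> (\<forall>x\<in>{0..1}. \<forall>y\<in>{0..1}. C x y = C' x y)"

definition le_on_square :: "(real \<Rightarrow> real \<Rightarrow> real) \<Rightarrow> (real \<Rightarrow> real \<Rightarrow> real) \<Rightarrow> bool" where
  "le_on_square C C' \<longleftrightarrow> (\<forall>x\<in>{0..1}. \<forall>y\<in>{0..1}. C x y \<le> C' x y)"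

definition undominated :: "(real \<Rightarrow> real) \<Rightarrow> (real \<Rightarrow> real \<Rightarrow> real) \<Rightarrow> bool" where
  "undominated \<delta> C \<longleftrightarrow> copula C \<and> has_diagonal_section C \<delta> \<and>
     \<not> (\<exists>C'. copula C' \<and> has_diagonal_section C' \<delta> \<and> \<not> eq_on_square C' C \<and> le_on_square C C')"

end

(* Within the copulas with diagonal section \<delta>, every copula C lies below one whose mass is
   carried by two increasing arcs, one on each side of the diagonal.  Such an arc copula is
   determined by the function g for which g v - g u is the mass below the diagonal over [u, v]:
   for x <= y its values at (x, y) and (y, x) are min x (\<delta> y - (g y - g x)) and
   min x (\<delta> x + (g y - g x)).  So undominated copulas are arc copulas.
   If \<delta> t = t for some t in [u, v], then all copulas agree at (u, v).  Otherwise, near the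
   diagonal both minima are attained by their second argument, so two arc copulas
   given by g1 and g2 differ at (s, t) and (t, s) by opposite amounts, namely by the increment
   of g1 - g2.  Unless g1 - g2 is locally constant this gives the pair of points; if it is,
   then the copulas coincide. *)
theory Submission
  imports Defs
begin

section \<open>Elementary properties of copulas\<close>

lemma copulaD:
  assumes "copula C" "0 \<le> x" "x \<le> 1"
  shows "C x 0 = 0" "C 0 x = 0" "C x 1 = x" "C 1 x = x"
  using assms by (auto simp: copula_def)

lemma copula_rectangle:
  assumes "copula C" "0 \<le> x1" "x1 \<le> x2" "x2 \<le> 1" "0 \<le> y1" "y1 \<le> y2" "y2 \<le> 1"
  shows "C x1 y2 + C x2 y1 \<le> C x2 y2 + C x1 y1"
proof -
  have "\<forall>x1\<in>{0..1}. \<forall>x2\<in>{0..1}. \<forall>y1\<in>{0..1}. \<forall>y2\<in>{0..1}.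
        x1 \<le> x2 \<longrightarrow> y1 \<le> y2 \<longrightarrow> C x2 y2 - C x1 y2 - C x2 y1 + C x1 y1 \<ge> 0"
    using assms(1) unfolding copula_def by blast
  moreover have "x1 \<in> {0..1}" "x2 \<in> {0..1}" "y1 \<in> {0..1}" "y2 \<in> {0..1}"
    using assms by auto
  ultimately have "C x2 y2 - C x1 y2 - C x2 y1 + C x1 y1 \<ge> 0"
    using assms(3,6) by blast
  then show ?thesis by linarith
qed

lemma copula_increment_left:
  assumes "copula C" "0 \<le> x1" "x1 \<le> x2" "x2 \<le> 1" "0 \<le> y" "y \<le> 1"
  shows "C x1 y \<le> C x2 y" "C x2 y \<le> C x1 y + (x2 - x1)"
  using copula_rectangle[OF assms(1-4), of 0 y] copula_rectangle[OF assms(1-4), of y 1]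
    copulaD[OF assms(1), of x1] copulaD[OF assms(1), of x2] assms by auto

lemma copula_increment_right:
  assumes "copula C" "0 \<le> y1" "y1 \<le> y2" "y2 \<le> 1" "0 \<le> x" "x \<le> 1"
  shows "C x y1 \<le> C x y2" "C x y2 \<le> C x y1 + (y2 - y1)"
  using copula_rectangle[OF assms(1), of 0 x y1 y2] copula_rectangle[OF assms(1), of x 1 y1 y2]
    copulaD[OF assms(1), of y1] copulaD[OF assms(1), of y2] assms by auto

lemma copula_le_min:
  assumes "copula C" "0 \<le> x" "x \<le> 1" "0 \<le> y" "y \<le> 1"
  shows "C x y \<le> min x y"
  using copula_increment_left(1)[OF assms(1), of x 1 y] copula_increment_right(1)[OF assms(1), of y 1 x]
    copulaD[OF assms(1), of x] copulaD[OF assms(1), of y] assms by auto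

text \<open>The strips \<open>[0, t] x [0, 1]\<close> and \<open>[0, 1] x [0, t]\<close> both have
  mass \<open>t\<close>. If the square on \<open>[0, t]\<close> carries all of it, neither strip has
  mass outside that square.\<close>

lemma copula_eq_min:
  assumes C: "copula C" and "C t t = t" "0 \<le> u" "u \<le> t" "t \<le> v" "v \<le> 1"
  shows "C u v = u" "C v u = u"
proof -
  show "C u v = u"
    using copula_increment_left(2)[OF C, of u t t] copula_increment_right(1)[OF C, of t v u]
      copula_le_min[OF C, of u v] assms by auto
  show "C v u = u"
    using copula_increment_right(2)[OF C, of u t t] copula_increment_left(1)[OF C, of t v u]
      copula_le_min[OF C, of v u] assms by auto
qed

section \<open>Splitting the mass over the two sides of the diagonal\<close>

text \<open>\<open>g v - g u\<close> plays the role of the mass of \<open>C\<close> below the diagonal over \<open>[u, v]\<close>; the two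
  bounds are the masses of \<open>[u, v] \<times> [0, u]\<close> and of \<open>[u, v] \<times> [0, v]\<close>.\<close>

definition splits_mass :: "(real \<Rightarrow> real \<Rightarrow> real) \<Rightarrow> (real \<Rightarrow> real) \<Rightarrow> bool" where
  "splits_mass C g \<longleftrightarrow> (\<forall>u v. 0 \<le> u \<longrightarrow> u \<le> v \<longrightarrow> v \<le> 1 \<longrightarrow>
     C v u - C u u \<le> g v - g u \<and> g v - g u \<le> C v v - C u v)"

lemma splits_massD:
  assumes "splits_mass C g" "0 \<le> u" "u \<le> v" "v \<le> 1"
  shows "C v u - C u u \<le> g v - g u" "g v - g u \<le> C v v - C u v"
  using assms unfolding splits_mass_def by blast+

text \<open>\<open>upper_sum C v s\<close>: \<open>s\<close> is the sum of the upper bounds of \<open>splits_mass\<close> over the steps of a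
  partition of \<open>[0, v]\<close>.  Refining a partition lowers this sum and raises that of the lower
  bounds, so the infimum of the upper sums meets both bounds.\<close>

inductive upper_sum :: "(real \<Rightarrow> real \<Rightarrow> real) \<Rightarrow> real \<Rightarrow> real \<Rightarrow> bool" for C where
  start: "upper_sum C 0 0"
| step: "upper_sum C u s \<Longrightarrow> 0 \<le> u \<Longrightarrow> u \<le> v \<Longrightarrow> v \<le> 1 \<Longrightarrow> upper_sum C v (s + (C v v - C u v))"

text \<open>Cutting a partition of \<open>[0, w]\<close> at \<open>v\<close> lowers its sum by at
  least the lower bound over \<open>[v, w]\<close>. This yields the left inequality of
  \<open>splits_mass\<close> for the infimum.\<close>

lemma upper_sum_truncate:
  assumes C: "copula C" and "upper_sum C w s" "0 \<le> v" "v \<le> w" "w \<le> 1"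
  shows "\<exists>s'. upper_sum C v s' \<and> s' + (C w v - C v v) \<le> s"
  using assms(2-)
proof (induction arbitrary: v)
  case start
  then have "v = 0" by simp
  then show ?case using upper_sum.start by force
next
  case (step u s w)
  show ?case
  proof (cases "v \<le> u")
    case True
    then obtain s' where s': "upper_sum C v s'" "s' + (C u v - C v v) \<le> s"
      using step by force
    \<comment> \<open>The mass of \<open>[u, w] x [v, w]\<close> is nonnegative, so moving the right
      end from \<open>u\<close> to \<open>w\<close> raises the lower bound by no more than the last
      step adds to the sum.\<close>
    have "C u w + C w v \<le> C w w + C u v"
      using copula_rectangle[OF C, of u w v w] step True by simp
    then have "s' + (C w v - C v v) \<le> s + (C w w - C u w)"
      using s' by simp
    then show ?thesis using s' by blast
  next
    case False
    \<comment> \<open>Here \<open>v\<close> falls inside the last step, which is shortened to end at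
      \<open>v\<close>.\<close>
    have "upper_sum C v (s + (C v v - C u v))"
      using upper_sum.step[OF step.hyps(1), of v] step False by simp
    moreover have "C u w + C w v \<le> C w w + C u v"
      using copula_rectangle[OF C, of u w v w] step False by simp
    then have "s + (C v v - C u v) + (C w v - C v v) \<le> s + (C w w - C u w)"
      by simp
    ultimately show ?thesis by blast
  qed
qed

lemma splits_mass_exists:
  assumes C: "copula C"
  shows "\<exists>g. splits_mass C g"
proof -
  define S where "S t = {s. upper_sum C t s}" for t
  have nonempty: "S t \<noteq> {}" if "0 \<le> t" "t \<le> 1" for t
    using upper_sum.step[OF upper_sum.start, of t] that by (auto simp: S_def)
  have nonneg: "0 \<le> s" if "upper_sum C t s" for t s
    using that
  proof induction
    case (step u s v)
    then show ?case using copula_increment_left(1)[OF C, of u v v] by simp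
  qed simp
  have bdd: "bdd_below (S t)" for t
    by (rule bdd_belowI[of _ 0]) (use nonneg in \<open>auto simp: S_def\<close>)
  have "splits_mass C (\<lambda>t. Inf (S t))"
    unfolding splits_mass_def
  proof (intro allI impI conjI)
    fix u v :: real
    assume uv: "0 \<le> u" "u \<le> v" "v \<le> 1"
    have "Inf (S u) + (C v u - C u u) \<le> Inf (S v)"
    proof (rule cInf_greatest)
      show "S v \<noteq> {}" using nonempty uv by simp
      fix s assume "s \<in> S v"
      then obtain s' where "s' \<in> S u" "s' + (C v u - C u u) \<le> s"
        using upper_sum_truncate[OF C, of v s u] uv by (auto simp: S_def)
      then show "Inf (S u) + (C v u - C u u) \<le> s"
        using cInf_lower[OF _ bdd, of s' u] by linarith
    qed
    then show "C v u - C u u \<le> Inf (S v) - Inf (S u)" by linarith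
    \<comment> \<open>Appending the single step from \<open>u\<close> to \<open>v\<close> turns any
      sum for \<open>u\<close> into one for \<open>v\<close>.\<close>
    have "Inf (S v) - (C v v - C u v) \<le> Inf (S u)"
    proof (rule cInf_greatest)
      show "S u \<noteq> {}" using nonempty uv by simp
      fix s assume "s \<in> S u"
      then have "s + (C v v - C u v) \<in> S v"
        using upper_sum.step[of C u s v] uv by (simp add: S_def)
      then show "Inf (S v) - (C v v - C u v) \<le> s"
        using cInf_lower[OF _ bdd, of _ v] by force
    qed
    then show "Inf (S v) - Inf (S u) \<le> C v v - C u v" by linarith
  qed
  then show ?thesis by blast
qed

section \<open>Arc copulas\<close>

definition arc_copula :: "(real \<Rightarrow> real) \<Rightarrow> (real \<Rightarrow> real) \<Rightarrow> real \<Rightarrow> real \<Rightarrow> real" where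
  "arc_copula \<delta> g x y =
     (if x \<le> y then min x (\<delta> y - (g y - g x)) else min y (\<delta> y + (g x - g y)))"

lemma arc_copula_simps:
  assumes "u \<le> v"
  shows "arc_copula \<delta> g u v = min u (\<delta> v - (g v - g u))"
    and "arc_copula \<delta> g v u = min u (\<delta> u + (g v - g u))"
  using assms by (auto simp: arc_copula_def)

text \<open>A rectangle that meets the diagonal is cut into a square centred on the diagonal and
  rectangles lying on one side of it. Thus a function given by different formulas on the two sides
  can be checked on each side separately.\<close>

lemma rectangle_nonneg_from_triangles:
  fixes F :: "real \<Rightarrow> real \<Rightarrow> real"
  assumes upper: "\<And>x1 x2 y1 y2. 0 \<le> x1 \<Longrightarrow> x1 \<le> x2 \<Longrightarrow> x2 \<le> y1 \<Longrightarrow> y1 \<le> y2 \<Longrightarrow> y2 \<le> 1 \<Longrightarrow>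
      F x2 y2 - F x1 y2 - F x2 y1 + F x1 y1 \<ge> 0"
    and lower: "\<And>x1 x2 y1 y2. 0 \<le> y1 \<Longrightarrow> y1 \<le> y2 \<Longrightarrow> y2 \<le> x1 \<Longrightarrow> x1 \<le> x2 \<Longrightarrow> x2 \<le> 1 \<Longrightarrow>
      F x2 y2 - F x1 y2 - F x2 y1 + F x1 y1 \<ge> 0"
    and square: "\<And>u v. 0 \<le> u \<Longrightarrow> u \<le> v \<Longrightarrow> v \<le> 1 \<Longrightarrow> F v v - F u v - F v u + F u u \<ge> 0"
    and xy: "0 \<le> x1" "x1 \<le> x2" "x2 \<le> 1" "0 \<le> y1" "y1 \<le> y2" "y2 \<le> 1"
  shows "F x2 y2 - F x1 y2 - F x2 y1 + F x1 y1 \<ge> 0"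
proof -
  consider "x2 \<le> y1" | "y2 \<le> x1"
    | "x1 \<le> y1" "y1 \<le> x2" "x2 \<le> y2" | "x1 \<le> y1" "y2 \<le> x2"
    | "y1 \<le> x1" "x2 \<le> y2" | "y1 \<le> x1" "x1 \<le> y2" "y2 \<le> x2"
    by linarith
  then show ?thesis
  proof cases
    case 1 then show ?thesis using upper xy by simp
  next
    case 2 then show ?thesis using lower xy by simp
  next
    case 3
    then show ?thesis
      using upper[of x1 y1 y1 y2] square[of y1 x2] upper[of y1 x2 x2 y2] xy by linarith
  next
    case 4
    then show ?thesis
      using upper[of x1 y1 y1 y2] square[of y1 y2] lower[of y1 y2 y2 x2] xy by linarith
  next
    case 5
    then show ?thesis
      using lower[of y1 x1 x1 x2] square[of x1 x2] upper[of x1 x2 x2 y2] xy by linarith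
  next
    case 6
    then show ?thesis
      using lower[of y1 x1 x1 x2] square[of x1 y2] lower[of x1 y2 y2 x2] xy by linarith
  qed
qed

lemma min_rectangle_nonneg:
  fixes a1 a2 b1 b2 :: real
  assumes "a1 \<le> a2" "b1 \<le> b2"
  shows "min a2 b2 - min a1 b2 - min a2 b1 + min a1 b1 \<ge> 0"
  using assms by (auto simp: min_def)

text \<open>These bounds make \<open>t - g t\<close> and \<open>\<delta> t - g t\<close>
  nondecreasing, as needed above the diagonal, and \<open>g t\<close> and
  \<open>t - \<delta> t + g t\<close>, as needed below it.\<close>

lemma splits_mass_bounds:
  assumes C: "copula C" and diag: "has_diagonal_section C \<delta>" and g: "splits_mass C g"
    and uv: "0 \<le> u" "u \<le> v" "v \<le> 1"
  shows "0 \<le> g v - g u" "g v - g u \<le> v - u" "g v - g u \<le> \<delta> v - \<delta> u"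
    "\<delta> v - \<delta> u - (v - u) \<le> g v - g u"
proof -
  have "C u u = \<delta> u" "C v v = \<delta> v"
    using diag uv by (auto simp: has_diagonal_section_def)
  then show "0 \<le> g v - g u" "g v - g u \<le> v - u" "g v - g u \<le> \<delta> v - \<delta> u"
    "\<delta> v - \<delta> u - (v - u) \<le> g v - g u"
    using splits_massD[OF g uv] copula_increment_left[OF C uv, of u]
      copula_increment_left[OF C uv, of v] copula_increment_right[OF C uv, of u]
      copula_increment_right[OF C uv, of v] uv
    by linarith+
qed

lemma copula_diagonal:
  assumes C: "copula C" and diag: "has_diagonal_section C \<delta>"
  shows "\<delta> 0 = 0" "\<delta> 1 = 1" "0 \<le> t \<Longrightarrow> t \<le> 1 \<Longrightarrow> 0 \<le> \<delta> t" "0 \<le> t \<Longrightarrow> t \<le> 1 \<Longrightarrow> \<delta> t \<le> t"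
proof -
  have d: "C t t = \<delta> t" if "0 \<le> t" "t \<le> 1" for t
    using diag that by (simp add: has_diagonal_section_def)
  show "\<delta> 0 = 0" "\<delta> 1 = 1"
    using d[of 0] d[of 1] copulaD[OF C, of 1] copulaD[OF C, of 0] by auto
  show "0 \<le> \<delta> t" if "0 \<le> t" "t \<le> 1"
    using C d[OF that] that unfolding copula_def by (metis atLeastAtMost_iff)
  show "\<delta> t \<le> t" if "0 \<le> t" "t \<le> 1"
    using copula_le_min[OF C, of t t] d[OF that] that by auto
qed

lemma copula_arc_copula:
  assumes C: "copula C" and diag: "has_diagonal_section C \<delta>" and g: "splits_mass C g"
  shows "copula (arc_copula \<delta> g)"
proof -
  let ?A = "arc_copula \<delta> g"
  note bounds = splits_mass_bounds[OF C diag g]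
  note \<delta> = copula_diagonal[OF C diag]
  have range_le: "0 \<le> ?A u v \<and> ?A u v \<le> 1 \<and> 0 \<le> ?A v u \<and> ?A v u \<le> 1"
    if "0 \<le> u" "u \<le> v" "v \<le> 1" for u v
    using bounds[OF that] \<delta>(3)[of u] that by (auto simp: arc_copula_simps min_def)
  have range: "?A x y \<in> {0..1}" if "x \<in> {0..1}" "y \<in> {0..1}" for x y
    using range_le[of x y] range_le[of y x] that by (cases "x \<le> y") auto
  have margins: "?A x 0 = 0 \<and> ?A 0 x = 0 \<and> ?A x 1 = x \<and> ?A 1 x = x" if "x \<in> {0..1}" for x
    using bounds[of 0 x] bounds[of x 1] \<delta>(1,2) that by (auto simp: arc_copula_simps min_def)
  have "?A x2 y2 - ?A x1 y2 - ?A x2 y1 + ?A x1 y1 \<ge> 0"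
    if "0 \<le> x1" "x1 \<le> x2" "x2 \<le> 1" "0 \<le> y1" "y1 \<le> y2" "y2 \<le> 1" for x1 x2 y1 y2
  proof (rule rectangle_nonneg_from_triangles[OF _ _ _ that])
    fix x1 x2 y1 y2 :: real
    assume xy: "0 \<le> x1" "x1 \<le> x2" "x2 \<le> y1" "y1 \<le> y2" "y2 \<le> 1"
    \<comment> \<open>The summand outside the minimum depends on one variable only and cancels over
      a rectangle. What remains is the minimum of a nondecreasing function of \<open>x\<close> and
      one of \<open>y\<close>. The case below the diagonal is analogous.\<close>
    have eq: "?A x y = g x + min (x - g x) (\<delta> y - g y)" if "x \<le> y" for x y
      using that by (auto simp: arc_copula_simps min_def)
    have "x1 - g x1 \<le> x2 - g x2" "\<delta> y1 - g y1 \<le> \<delta> y2 - g y2"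
      using bounds(2)[of x1 x2] bounds(3)[of y1 y2] xy by linarith+
    from min_rectangle_nonneg[OF this]
    show "?A x2 y2 - ?A x1 y2 - ?A x2 y1 + ?A x1 y1 \<ge> 0"
      using xy by (simp add: eq)
  next
    fix x1 x2 y1 y2 :: real
    assume xy: "0 \<le> y1" "y1 \<le> y2" "y2 \<le> x1" "x1 \<le> x2" "x2 \<le> 1"
    have eq: "?A x y = \<delta> y - g y + min (g x) (y - \<delta> y + g y)" if "y \<le> x" for x y
      using that by (auto simp: arc_copula_simps min_def)
    have "g x1 \<le> g x2" "y1 - \<delta> y1 + g y1 \<le> y2 - \<delta> y2 + g y2"
      using bounds(1)[of x1 x2] bounds(4)[of y1 y2] xy by linarith+
    from min_rectangle_nonneg[OF this]
    show "?A x2 y2 - ?A x1 y2 - ?A x2 y1 + ?A x1 y1 \<ge> 0"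
      using xy by (simp add: eq)
  next
    fix u v :: real
    assume uv: "0 \<le> u" "u \<le> v" "v \<le> 1"
    \<comment> \<open>The increments of \<open>g\<close> cancel, so \<open>?A u v + ?A v u\<close>
      is at most \<open>\<delta> v + \<delta> u\<close>.\<close>
    then show "?A v v - ?A u v - ?A v u + ?A u u \<ge> 0"
      using \<delta>(4)[of u] \<delta>(4)[of v] by (auto simp: arc_copula_simps min_def)
  qed
  then show ?thesis
    using range margins unfolding copula_def by auto
qed

lemma has_diagonal_section_arc_copula:
  assumes "copula C" "has_diagonal_section C \<delta>"
  shows "has_diagonal_section (arc_copula \<delta> g) \<delta>"
  using copula_diagonal(4)[OF assms] by (auto simp: has_diagonal_section_def arc_copula_simps)

text \<open>Solved for \<open>C u v\<close> and \<open>C v u\<close>, the two bounds of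
  \<open>splits_mass\<close> give the second arguments of the minima; \<open>copula_le_min\<close>
  gives the first.\<close>

lemma le_arc_copula:
  assumes C: "copula C" and diag: "has_diagonal_section C \<delta>" and g: "splits_mass C g"
  shows "le_on_square C (arc_copula \<delta> g)"
proof -
  have le: "C u v \<le> arc_copula \<delta> g u v \<and> C v u \<le> arc_copula \<delta> g v u"
    if uv: "0 \<le> u" "u \<le> v" "v \<le> 1" for u v
  proof -
    have "C u u = \<delta> u" "C v v = \<delta> v"
      using diag uv by (auto simp: has_diagonal_section_def)
    then show ?thesis
      using splits_massD[OF g uv] copula_le_min[OF C, of u v] copula_le_min[OF C, of v u] uv
      by (auto simp: arc_copula_simps)
  qed
  show ?thesis
    unfolding le_on_square_def
  proof (intro ballI)
    fix x y :: real
    assume "x \<in> {0..1}" "y \<in> {0..1}"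
    then show "C x y \<le> arc_copula \<delta> g x y"
      using le[of x y] le[of y x] by (cases "x \<le> y") auto
  qed
qed

lemma undominated_is_arc_copula:
  assumes "undominated \<delta> C"
  obtains g where "splits_mass C g" "eq_on_square (arc_copula \<delta> g) C"
proof -
  have C: "copula C" and diag: "has_diagonal_section C \<delta>"
    using assms by (auto simp: undominated_def)
  obtain g where g: "splits_mass C g"
    using splits_mass_exists[OF C] by blast
  have "eq_on_square (arc_copula \<delta> g) C"
    using assms copula_arc_copula[OF C diag g] has_diagonal_section_arc_copula[OF C diag]
      le_arc_copula[OF C diag g] unfolding undominated_def by blast
  with g that show thesis by blast
qed

section \<open>Comparing two undominated copulas\<close>

text \<open>The increment of \<open>g\<close> lies between 0 and
  \<open>\<delta> t - \<delta> s\<close>, so both second arguments are at most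
  \<open>\<delta> t\<close>, hence at most \<open>s\<close>.\<close>

lemma arc_copula_near_diagonal:
  assumes "copula C" "has_diagonal_section C \<delta>" "splits_mass C g"
    and "0 \<le> s" "s \<le> t" "t \<le> 1" "\<delta> t \<le> s"
  shows "arc_copula \<delta> g s t = \<delta> t - (g t - g s)"
    and "arc_copula \<delta> g t s = \<delta> s + (g t - g s)"
  using splits_mass_bounds[OF assms(1-6)] assms(5,7) by (auto simp: arc_copula_simps)

theorem mainTheorem2:
  fixes C1 C2 :: "real \<Rightarrow> real \<Rightarrow> real" and \<delta> :: "real \<Rightarrow> real"
  assumes "copula C1" and "copula C2"
    and "\<not> eq_on_square C1 C2"
    and "has_diagonal_section C1 \<delta>" and "has_diagonal_section C2 \<delta>"
    and "undominated \<delta> C1" and "undominated \<delta> C2"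
  shows "\<exists>u\<in>{0..1}. \<exists>v\<in>{0..1}. u \<noteq> v \<and> C1 u v > C2 u v \<and> C2 v u > C1 v u"
proof (rule ccontr)
  assume "\<not> ?thesis"
  then have no_pair: "\<not> (C1 u v > C2 u v \<and> C2 v u > C1 v u)"
    if "0 \<le> u" "u \<le> 1" "0 \<le> v" "v \<le> 1" for u v
    using that by fastforce
  obtain g1 where g1: "splits_mass C1 g1" "eq_on_square (arc_copula \<delta> g1) C1"
    using undominated_is_arc_copula assms(6) by blast
  obtain g2 where g2: "splits_mass C2 g2" "eq_on_square (arc_copula \<delta> g2) C2"
    using undominated_is_arc_copula assms(7) by blast
  have C1: "C1 x y = arc_copula \<delta> g1 x y" and C2: "C2 x y = arc_copula \<delta> g2 x y"
    if "0 \<le> x" "x \<le> 1" "0 \<le> y" "y \<le> 1" for x y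
    using g1(2) g2(2) that by (auto simp: eq_on_square_def)
  have diag1: "C1 t t = \<delta> t" and diag2: "C2 t t = \<delta> t" if "0 \<le> t" "t \<le> 1" for t
    using assms(4,5) that by (auto simp: has_diagonal_section_def)
  \<comment> \<open>\<open>C1 - C2\<close> takes opposite values at \<open>(s, t)\<close> and
    \<open>(t, s)\<close>; were they nonzero, one of these two points would give the excluded
    pair.\<close>
  have near: "g1 t - g1 s = g2 t - g2 s" if "0 \<le> s" "s \<le> t" "t \<le> 1" "\<delta> t \<le> s" for s t
    using no_pair[of s t] no_pair[of t s] C1[of s t] C1[of t s] C2[of s t] C2[of t s]
      arc_copula_near_diagonal[OF assms(1,4) g1(1) that]
      arc_copula_near_diagonal[OF assms(2,5) g2(1) that] that
    by auto
  have same_increment: "g1 v - g1 u = g2 v - g2 u"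
    if uv: "0 \<le> u" "u \<le> v" "v \<le> 1" and below: "\<And>t. u \<le> t \<Longrightarrow> t \<le> v \<Longrightarrow> \<delta> t < t" for u v
  proof -
    \<comment> \<open>The trivial premises fit the interval predicate, whose guards are needed
      because the small intervals around a point may stick out of \<open>[u, v]\<close>.\<close>
    have "u \<le> u \<and> v \<le> v \<longrightarrow> g1 v - g1 u = g2 v - g2 u"
      using uv(2)
    proof (induction rule: Bolzano[where P = "\<lambda>s t. u \<le> s \<and> t \<le> v \<longrightarrow> g1 t - g1 s = g2 t - g2 s"])
      case (trans a b c)
      then show ?case by fastforce
    next
      case (local x)
      \<comment> \<open>The section is 2-Lipschitz, and
        \<open>2 * (t - x) + (x - s) \<le> 2 * (t - s) < x - \<delta> x\<close>; hence the factor
        1/2.\<close>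
      have "g1 t - g1 s = g2 t - g2 s"
        if st: "s \<le> x" "x \<le> t" "t - s < (x - \<delta> x) / 2" "u \<le> s" "t \<le> v" for s t
      proof (rule near)
        have "\<delta> t \<le> \<delta> x + 2 * (t - x)"
          using copula_increment_left(2)[OF assms(1), of x t t]
            copula_increment_right(2)[OF assms(1), of x t x] diag1[of x] diag1[of t] st uv by simp
        then show "\<delta> t \<le> s" using st by (simp add: field_simps)
      qed (use st uv in auto)
      moreover have "0 < (x - \<delta> x) / 2" using below local by simp
      ultimately show ?case by blast
    qed
    then show ?thesis by simp
  qed
  have eq: "C1 u v = C2 u v \<and> C1 v u = C2 v u" if uv: "0 \<le> u" "u \<le> v" "v \<le> 1" for u v
  proof (cases "\<exists>t. u \<le> t \<and> t \<le> v \<and> \<delta> t = t")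
    case True
    then obtain t where t: "u \<le> t" "t \<le> v" "\<delta> t = t" by blast
    then have "C1 t t = t" "C2 t t = t" using diag1[of t] diag2[of t] uv by auto
    then show ?thesis
      using copula_eq_min[OF assms(1), of t u v] copula_eq_min[OF assms(2), of t u v] t uv by simp
  next
    case False
    have "\<delta> t < t" if "u \<le> t" "t \<le> v" for t
      using copula_diagonal(4)[OF assms(1,4), of t] False that uv by fastforce
    then have "g1 v - g1 u = g2 v - g2 u" using same_increment uv by blast
    then show ?thesis using C1 C2 uv by (simp add: arc_copula_simps)
  qed
  have "eq_on_square C1 C2"
    unfolding eq_on_square_def
  proof (intro ballI)
    fix x y :: real
    assume "x \<in> {0..1}" "y \<in> {0..1}"
    then show "C1 x y = C2 x y"
      using eq[of x y] eq[of y x] by (cases "x \<le> y") auto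
  qed
  with assms(3) show False ..
qed

end
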